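(* Let $A\in\mathbb{R}^{2\times 2}$, let $\zeta\in\mathbb{R}^2$ be nonzero, let $\Omega=[u^-,u^+]$ with $u^-<u^+$, and consider the linear control system $\Sigma_{\mathbb{R}^2}$: $\dot v(t)=Av(t)+u(t)\zeta$, $u(t)\in\Omega$. Assume that $\Sigma_{\mathbb{R}^2}$ satisfies the LARC and that $\det A<0$. Fix a basis of $\mathbb{R}^2$ in which $A=\begin{pmatrix}\mu&0\\0&\lambda\end{pmatrix}$ with $\lambda<0<\mu$, and let $(\zeta_1,\zeta_2)$ be the coordinates of $\zeta$ in this basis. Then $\Sigma_{\mathbb{R}^2}$ admits a unique control set $\mathcal{C}_{\mathbb{R}^2}$, and in coordinates with respect to this basis it satisfies $$\mathcal{C}_{\mathbb{R}^2}=\Big(-\frac{\zeta_1}{\mu}\operatorname{int}\Omega\Big)\times\Big(-\frac{\zeta_2}{\lambda}\Omega\Big).$$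
   Context: The set $\mathcal{U}$ of control functions consists of all piecewise constant functions $\mathbf{u}:\mathbb{R}\to\mathbb{R}$ with image in $\Omega$. For $v\in\mathbb{R}^2$ and $\mathbf{u}\in\mathcal{U}$, $s\mapsto\varphi(s,v,\mathbf{u})$, $s\in\mathbb{R}$, is the unique continuous, piecewise differentiable solution of $\frac{d}{ds}\varphi(s,v,\mathbf{u})=A\varphi(s,v,\mathbf{u})+\mathbf{u}(s)\zeta$ with $\varphi(0,v,\mathbf{u})=v$. The positive orbit of $v$ is $\mathcal{O}^+(v)=\{\varphi(t,v,\mathbf{u}): t\ge 0,\ \mathbf{u}\in\mathcal{U}\}$. LARC: $\langle A\zeta,\theta\zeta\rangle\neq 0$, where $\theta$ is the counter-clockwise rotation by $\pi/2$; equivalently, $\zeta$ is not an eigenvector of $A$. A nonempty set $\mathcal{C}\subset\mathbb{R}^2$ is a control set of $\Sigma_{\mathbb{R}^2}$ if: (1) for every $v\in\mathcal{C}$ there is $\mathbf{u}\in\mathcal{U}$ with $\varphi(t,v,\mathbf{u})\in\mathcal{C}$ for all $t\geq 0$; (2) for every $v\in\mathcal{C}$, $\mathcal{C}\subset\overline{\mathcal{O}^+(v)}$; (3) $\mathcal{C}$ is maximal with respect to set inclusion among sets satisfying (1) and (2). For $c\in\mathbb{R}$ and $S\subset\mathbb{R}$, $cS=\{cs:s\in S\}$, and $\operatorname{int}\Omega=(u^-,u^+)$.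
   Formalization: Uniqueness and the formula are proved for control sets that are not a single point: under the definition as written, each one-point set {-u⁺A⁻¹ζ} and {-u⁻A⁻¹ζ} is also a control set, so the literal claim of a unique control set is false. *)

theory Defs
  imports "HOL-Analysis.Analysis"
begin

definition locally_finite_set :: "real set \<Rightarrow> bool" where
  "locally_finite_set S \<longleftrightarrow> (\<forall>a b. finite (S \<inter> {a..b}))"

text \<open>Switching times may accumulate only at infinity; the value of the function at a
  switching time is unrestricted.\<close>

definition piecewise_constant :: "(real \<Rightarrow> real) \<Rightarrow> bool" where
  "piecewise_constant u \<longleftrightarrow>
     (\<exists>S. locally_finite_set S \<and> (\<forall>s t. s \<le> t \<and> {s..t} \<inter> S = {} \<longrightarrow> u s = u t))"

definition control_functions :: "real set \<Rightarrow> (real \<Rightarrow> real) set" where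
  "control_functions \<Omega> = {u. piecewise_constant u \<and> range u \<subseteq> \<Omega>}"

definition is_solution ::
  "real^2^2 \<Rightarrow> real^2 \<Rightarrow> (real \<Rightarrow> real) \<Rightarrow> real^2 \<Rightarrow> (real \<Rightarrow> real^2) \<Rightarrow> bool" where
  "is_solution A \<zeta> u v x \<longleftrightarrow>
     continuous_on UNIV x \<and> x 0 = v \<and>
     (\<exists>S. locally_finite_set S \<and>
        (\<forall>s. s \<notin> S \<longrightarrow> (x has_vector_derivative (A *v x s + u s *\<^sub>R \<zeta>)) (at s)))"

definition trajectory ::
  "real^2^2 \<Rightarrow> real^2 \<Rightarrow> real \<Rightarrow> real^2 \<Rightarrow> (real \<Rightarrow> real) \<Rightarrow> real^2" where
  "trajectory A \<zeta> s v u = (THE x. is_solution A \<zeta> u v x) s"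

definition positive_orbit :: "real^2^2 \<Rightarrow> real^2 \<Rightarrow> real set \<Rightarrow> real^2 \<Rightarrow> (real^2) set" where
  "positive_orbit A \<zeta> \<Omega> v = {trajectory A \<zeta> t v u | t u. t \<ge> 0 \<and> u \<in> control_functions \<Omega>}"

text \<open>Counter-clockwise rotation by a right angle.\<close>

definition rot :: "real^2 \<Rightarrow> real^2" where
  "rot v = vector [- (v $ 2), v $ 1]"

definition LARC :: "real^2^2 \<Rightarrow> real^2 \<Rightarrow> bool" where
  "LARC A \<zeta> \<longleftrightarrow> (A *v \<zeta>) \<bullet> rot \<zeta> \<noteq> 0"

definition viable_approx_controllable ::
  "real^2^2 \<Rightarrow> real^2 \<Rightarrow> real set \<Rightarrow> (real^2) set \<Rightarrow> bool" where
  "viable_approx_controllable A \<zeta> \<Omega> C \<longleftrightarrow>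
     (\<forall>v\<in>C. \<exists>u\<in>control_functions \<Omega>. \<forall>t\<ge>0. trajectory A \<zeta> t v u \<in> C) \<and>
     (\<forall>v\<in>C. C \<subseteq> closure (positive_orbit A \<zeta> \<Omega> v))"

definition control_set :: "real^2^2 \<Rightarrow> real^2 \<Rightarrow> real set \<Rightarrow> (real^2) set \<Rightarrow> bool" where
  "control_set A \<zeta> \<Omega> C \<longleftrightarrow>
     C \<noteq> {} \<and> viable_approx_controllable A \<zeta> \<Omega> C \<and>
     (\<forall>D. viable_approx_controllable A \<zeta> \<Omega> D \<and> C \<subseteq> D \<longrightarrow> D = C)"

text \<open>A one-point set consisting of an equilibrium of \<open>v' = A v + u \<zeta>\<close> for a constant
  control \<open>u\<close> can be maximal. Under the LARC, if \<open>det A < 0\<close> and \<open>\<Omega> = {um..up}\<close>, this happens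
  exactly for the equilibria of the two extreme values \<open>um\<close> and \<open>up\<close>: they lie on the repelling
  edges of the control set with nonempty interior and cannot be steered back into it. Uniqueness
  of the control set therefore has to be read modulo one-point sets.\<close>

end

theory Submission
  imports Defs "HOL-Real_Asymp.Real_Asymp"
begin

text \<open>In rescaled eigencoordinates the system is \<open>X' = mu (X - u)\<close>, \<open>Y' = l (u - Y)\<close> with
  \<open>mu, l > 0\<close>. Inside \<open>um < X < up\<close>, a constant control near the current \<open>X\<close>, held for a long time,
  takes \<open>X\<close> to any prescribed value while \<open>Y\<close> converges to the control; two such phases
  approximately reach every point of the rectangle. Conversely, \<open>max X up\<close> and \<open>- max Y up\<close> never
  decrease and increase strictly outside the closed rectangle, so a set satisfying viability and
  approximate controllability lies inside it. On the repelling edge \<open>X = up\<close>, every trajectory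
  increases \<open>X / mu + Y / l\<close>, strictly unless it starts in the corner, which leaves only the
  one-point set of that corner. The edges \<open>um\<close> follow from the symmetry \<open>(X, Y, u) \<mapsto> (- X, - Y, - u)\<close>.\<close>

section \<open>Calculus away from a locally finite exceptional set\<close>

text \<open>The fundamental theorem of calculus tolerates the finitely many points of
  \<open>S\<close> in \<open>{a..b}\<close>, so the integral of the derivative can be compared with
  that of the constant \<open>k\<close>.\<close>

lemma nonneg_deriv_imp_le_off_locally_finite:
  fixes f f' :: "real \<Rightarrow> real"
  assumes "locally_finite_set S" "continuous_on UNIV f" "a \<le> b"
    and der: "\<And>s. s \<notin> S \<Longrightarrow> a < s \<Longrightarrow> s < b \<Longrightarrow> (f has_real_derivative f' s) (at s)"
    and ge: "\<And>s. s \<notin> S \<Longrightarrow> a < s \<Longrightarrow> s < b \<Longrightarrow> k \<le> f' s"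
  shows "f a + k * (b - a) \<le> f b"
proof -
  \<comment> \<open>Filling the exceptional points and the end points with \<open>k\<close> makes
    \<open>k \<le> g\<close> hold on all of \<open>{a..b}\<close> without changing the
    integral.\<close>
  define g where "g s = (if s \<in> S \<or> s \<le> a \<or> b \<le> s then k else f' s)" for s
  have "(g has_integral (f b - f a)) {a..b}"
  proof (rule fundamental_theorem_of_calculus_interior_strong[where S = "S \<inter> {a..b}"])
    show "finite (S \<inter> {a..b})" using assms(1) by (simp add: locally_finite_set_def)
    show "continuous_on {a..b} f" using assms(2) continuous_on_subset by blast
    show "(f has_vector_derivative g x) (at x)" if "x \<in> {a<..<b} - S \<inter> {a..b}" for x
      using that der[of x]
      by (auto simp: g_def has_real_derivative_iff_has_vector_derivative)
  qed fact
  moreover have "((\<lambda>_. k) has_integral ((b - a) *\<^sub>R k)) {a..b}"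
    using has_integral_const_real[of k a b] assms(3) by simp
  ultimately have "(b - a) *\<^sub>R k \<le> f b - f a"
    by (elim has_integral_le[rotated]) (auto simp: g_def ge)
  then show ?thesis by (simp add: mult.commute)
qed

lemma zero_deriv_imp_eq_off_locally_finite:
  fixes f :: "real \<Rightarrow> real"
  assumes "locally_finite_set S" "continuous_on UNIV f" "a \<le> b"
    and der: "\<And>s. s \<notin> S \<Longrightarrow> a < s \<Longrightarrow> s < b \<Longrightarrow> (f has_real_derivative 0) (at s)"
  shows "f a = f b"
proof -
  have "f a \<le> f b"
    using nonneg_deriv_imp_le_off_locally_finite[OF assms(1-3), of "\<lambda>_. 0" 0] der by simp
  moreover have "- f a \<le> - f b"
    using nonneg_deriv_imp_le_off_locally_finite[OF assms(1) _ assms(3), of "\<lambda>s. - f s" "\<lambda>_. 0" 0]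
      der[THEN DERIV_minus] assms(2) by (simp add: continuous_on_minus)
  ultimately show ?thesis by simp
qed

lemma locally_finite_set_Un:
  "locally_finite_set S \<Longrightarrow> locally_finite_set T \<Longrightarrow> locally_finite_set (S \<union> T)"
  by (simp add: locally_finite_set_def Int_Un_distrib2)

lemma locally_finite_set_countable:
  assumes "locally_finite_set S"
  shows "countable S"
proof -
  have "S = (\<Union>n::nat. S \<inter> {- real n..real n})"
  proof (intro equalityI subsetI)
    fix s assume "s \<in> S"
    moreover obtain n :: nat where "\<bar>s\<bar> \<le> real n" using real_arch_simple by blast
    ultimately show "s \<in> (\<Union>n::nat. S \<inter> {- real n..real n})" by (auto intro!: exI[of _ n])
  qed auto
  moreover have "countable (\<Union>n::nat. S \<inter> {- real n..real n})"
    using assms by (intro countable_UN) (auto simp: locally_finite_set_def countable_finite)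
  ultimately show ?thesis by simp
qed

lemma locally_finite_set_gap:
  assumes "locally_finite_set S" "s \<notin> S"
  obtains e where "e > 0" "{s - e..s + e} \<inter> S = {}"
proof -
  have "finite (S \<inter> {s - 1..s + 1})" using assms(1) by (simp add: locally_finite_set_def)
  then obtain d where d: "d > 0" "\<And>x. x \<in> S \<inter> {s - 1..s + 1} \<Longrightarrow> x \<noteq> s \<Longrightarrow> d \<le> dist s x"
    using finite_set_avoid[of "S \<inter> {s - 1..s + 1}" s] by auto
  \<comment> \<open>Halving keeps the closed interval away from points at distance exactly
    \<open>d\<close>; the cap 1 keeps it in the window where \<open>S\<close> is known to be
    finite.\<close>
  define e where "e = min 1 (d / 2)"
  have "x \<notin> S" if "x \<in> {s - e..s + e}" for x
  proof
    assume "x \<in> S"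
    moreover have "x \<in> {s - 1..s + 1}" using that by (auto simp: e_def)
    ultimately have "d \<le> dist s x" using d(2)[of x] assms(2) by auto
    then show False using that d(1) by (auto simp: e_def dist_real_def abs_le_iff min_def split: if_splits)
  qed
  then show ?thesis using d(1) by (intro that[of e]) (auto simp: e_def)
qed

lemma piecewise_constant_isCont:
  assumes "locally_finite_set S" "\<And>s t. s \<le> t \<Longrightarrow> {s..t} \<inter> S = {} \<Longrightarrow> u s = u t" "s \<notin> S"
  shows "isCont u s"
proof -
  obtain e where e: "e > 0" "{s - e..s + e} \<inter> S = {}"
    using locally_finite_set_gap[OF assms(1,3)] .
  have "u r = u s" if "r \<in> {s - e<..<s + e}" for r
  proof (cases "r \<le> s")
    case True
    moreover have "{r..s} \<subseteq> {s - e..s + e}" using that by auto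
    ultimately show ?thesis using e by (intro assms(2)) blast+
  next
    case False
    moreover have "{s..r} \<subseteq> {s - e..s + e}" using that by auto
    ultimately show ?thesis using e by (intro assms(2)[symmetric]) (simp, blast)
  qed
  then have "continuous_on {s - e<..<s + e} u"
    by (metis continuous_on_cong continuous_on_const)
  then show ?thesis using e(1) by (simp add: continuous_on_eq_continuous_at)
qed

text \<open>Continuity off a countable set makes \<open>g\<close> Borel measurable, and local
  boundedness then makes it integrable on compact intervals; its indefinite integral has derivative
  \<open>g\<close> at every continuity point.\<close>

lemma antiderivative_off_locally_finite:
  fixes g :: "real \<Rightarrow> real"
  assumes S: "locally_finite_set S" and cont: "\<And>s. s \<notin> S \<Longrightarrow> isCont g s"
    and bnd: "\<And>a b. \<exists>B. \<forall>s\<in>{a..b}. \<bar>g s\<bar> \<le> B"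
  obtains G where "continuous_on UNIV G" "G 0 = 0"
    "\<And>s. s \<notin> S \<Longrightarrow> (G has_real_derivative g s) (at s)"
proof -
  have "continuous_on (- S) g"
    using cont by (auto intro!: continuous_at_imp_continuous_on)
  then have meas: "g \<in> borel_measurable borel"
    using S by (intro borel_measurable_continuous_countable_exceptions locally_finite_set_countable)
  have int: "g integrable_on {a..b}" for a b
  proof -
    obtain B where B: "\<And>s. s \<in> {a..b} \<Longrightarrow> \<bar>g s\<bar> \<le> B" using bnd by blast
    show ?thesis
    proof (rule measurable_bounded_by_integrable_imp_integrable)
      show "g \<in> borel_measurable (lebesgue_on {a..b})"
        using meas by (intro measurable_restrict_space1 measurable_completion) simp
      show "(\<lambda>_. B) integrable_on {a..b}" by (rule integrable_const_ivl)
    qed (use B in auto)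
  qed
  \<comment> \<open>The signed integral from 0 to \<open>s\<close>: one of the two terms always
    vanishes.\<close>
  define G where "G s = integral {0..s} g - integral {s..0} g" for s
  \<comment> \<open>Moving the base point to some \<open>a\<close> left of both 0 and
    \<open>s\<close> changes the integral only by a constant, so facts about integrals with a fixed
    left end also serve negative \<open>s\<close>.\<close>
  have G_eq: "G s = integral {a..s} g - integral {a..0} g" if "a \<le> s" "a \<le> 0" for a s
  proof (cases "0 \<le> s")
    case True
    have "integral {s..0} g = 0" using True by (cases "s = 0") auto
    then show ?thesis
      using Henstock_Kurzweil_Integration.integral_combine[of a 0 s g] that True int by (simp add: G_def)
  next
    case False
    then show ?thesis
      using Henstock_Kurzweil_Integration.integral_combine[of a s 0 g] that int by (simp add: G_def)
  qed
  have near: "\<forall>\<^sub>F t in nhds s. G t = integral {a..t} g - integral {a..0} g"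
    if "a < s" "a < 0" for a s
    using eventually_nhds_in_open[of "{a<..}" s] that
    by (auto elim!: eventually_mono intro!: G_eq)
  have "isCont G s" for s
  proof -
    define a where "a = - \<bar>s\<bar> - 1"
    have "continuous_on {a..s + 1} (\<lambda>t. integral {a..t} g)"
      by (rule indefinite_integral_continuous_1[OF int])
    then have "isCont (\<lambda>t. integral {a..t} g) s"
      by (rule continuous_on_interior) (auto simp: a_def)
    then have "isCont (\<lambda>t. integral {a..t} g - integral {a..0} g) s"
      by (intro continuous_intros)
    then show ?thesis
      using isCont_cong[OF near[of a s]] by (simp add: a_def)
  qed
  moreover have "(G has_real_derivative g s) (at s)" if "s \<notin> S" for s
  proof -
    define a where "a = - \<bar>s\<bar> - 1"
    have "((\<lambda>t. integral {a..t} g) has_vector_derivative g s) (at s within ({a..s + 1} - {}))"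
      using cont[OF that]
      by (intro integral_has_vector_derivative_continuous_at int)
        (auto simp: a_def intro: continuous_at_imp_continuous_at_within)
    moreover have "at s within {a..s + 1} = at s"
      by (rule at_within_interior) (auto simp: a_def)
    ultimately have "((\<lambda>t. integral {a..t} g) has_real_derivative g s) (at s)"
      by (simp add: has_real_derivative_iff_has_vector_derivative)
    then have "((\<lambda>t. integral {a..t} g - integral {a..0} g) has_real_derivative g s) (at s)"
      by (auto intro!: derivative_eq_intros)
    then show ?thesis
      using DERIV_cong_ev[OF refl near[of a s] refl] by (simp add: a_def)
  qed
  ultimately show ?thesis
    by (intro that[of G] continuous_at_imp_continuous_on) (auto simp: G_def)
qed

text \<open>Variation of constants: \<open>g\<close> is the control term times the integrating
  factor \<open>exp (- (a * s))\<close>, and the solution is \<open>exp (a * s)\<close> times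
  \<open>p0\<close> plus the antiderivative of \<open>g\<close>.\<close>

lemma piecewise_constant_linear_ode_ex:
  assumes S: "locally_finite_set S" "\<And>s t. s \<le> t \<Longrightarrow> {s..t} \<inter> S = {} \<Longrightarrow> u s = u t"
    and bnd: "range u \<subseteq> {um..up}"
  obtains p where "continuous_on UNIV p" "p 0 = p0"
    "\<And>s. s \<notin> S \<Longrightarrow> (p has_real_derivative (a * p s + b * u s)) (at s)"
proof -
  define g where "g s = b * exp (- (a * s)) * u s" for s
  obtain G where G: "continuous_on UNIV G" "G 0 = 0"
    "\<And>s. s \<notin> S \<Longrightarrow> (G has_real_derivative g s) (at s)"
  proof (rule antiderivative_off_locally_finite[OF S(1), of g])
    show "isCont g s" if "s \<notin> S" for s
      unfolding g_def using piecewise_constant_isCont[OF S that] by (intro continuous_intros)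
    show "\<exists>B. \<forall>s\<in>{c..d}. \<bar>g s\<bar> \<le> B" for c d
    proof -
      have "bounded ((\<lambda>s. b * exp (- (a * s))) ` {c..d})"
        by (intro compact_imp_bounded compact_continuous_image continuous_intros compact_Icc)
      then obtain B where B: "\<And>s. s \<in> {c..d} \<Longrightarrow> \<bar>b * exp (- (a * s))\<bar> \<le> B"
        unfolding bounded_iff by fastforce
      have u: "\<bar>u s\<bar> \<le> \<bar>um\<bar> + \<bar>up\<bar>" for s
      proof -
        have "u s \<in> {um..up}" using bnd by blast
        then show ?thesis by auto
      qed
      have "\<bar>g s\<bar> \<le> B * (\<bar>um\<bar> + \<bar>up\<bar>)" if "s \<in> {c..d}" for s
      proof -
        have "\<bar>g s\<bar> = \<bar>b * exp (- (a * s))\<bar> * \<bar>u s\<bar>" by (simp add: g_def abs_mult)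
        also have "\<dots> \<le> B * (\<bar>um\<bar> + \<bar>up\<bar>)"
          using B[OF that] u[of s] by (intro mult_mono) (auto intro: order_trans[OF abs_ge_zero])
        finally show ?thesis .
      qed
      then show ?thesis by blast
    qed
  qed blast
  show ?thesis
  proof (rule that[of "\<lambda>s. exp (a * s) * (p0 + G s)"])
    show "continuous_on UNIV (\<lambda>s. exp (a * s) * (p0 + G s))"
      using G(1) by (intro continuous_intros)
    show "((\<lambda>s. exp (a * s) * (p0 + G s)) has_real_derivative
        a * (exp (a * s) * (p0 + G s)) + b * u s) (at s)" if "s \<notin> S" for s
      using G(3)[OF that]
      by (auto intro!: derivative_eq_intros simp: g_def exp_minus field_simps)
  qed (simp add: G(2))
qed


section \<open>Solutions of the saddle system in rescaled eigencoordinates\<close>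

lemma exp_mult_exp_mult: "exp a * (exp b * c) = exp (a + b) * (c :: real)"
  by (simp add: exp_add)

text \<open>The coordinates are rescaled so that a trajectory satisfies \<open>X' = mu (X - u)\<close> and
  \<open>Y' = l (u - Y)\<close>; the equilibrium of a constant control \<open>c\<close> is then \<open>X = Y = c\<close>.\<close>

locale saddle =
  fixes A :: "real^2^2" and \<zeta> :: "real^2" and um up mu l :: real
    and X Y :: "real^2 \<Rightarrow> real" and e1 e2 :: "real^2"
  assumes um_up: "um < up" and mu: "0 < mu" and l: "0 < l"
    and linear_X: "linear X" and linear_Y: "linear Y"
    and decomp: "v = X v *\<^sub>R e1 + Y v *\<^sub>R e2"
    and X_e1: "X e1 = 1" and X_e2: "X e2 = 0" and Y_e1: "Y e1 = 0" and Y_e2: "Y e2 = 1"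
    and X_A: "X (A *v v) = mu * X v" and Y_A: "Y (A *v v) = - l * Y v"
    and X_zeta: "X \<zeta> = - mu" and Y_zeta: "Y \<zeta> = l"
begin

lemmas X_simps = linear_add[OF linear_X] linear_cmul[OF linear_X] X_e1 X_e2 X_A X_zeta
lemmas Y_simps = linear_add[OF linear_Y] linear_cmul[OF linear_Y] Y_e1 Y_e2 Y_A Y_zeta

lemma continuous_on_X: "continuous_on S f \<Longrightarrow> continuous_on S (\<lambda>x. X (f x))"
  and continuous_on_Y: "continuous_on S f \<Longrightarrow> continuous_on S (\<lambda>x. Y (f x))"
  using linear_X linear_Y by (simp_all add: linear_conv_bounded_linear bounded_linear.continuous_on)

lemma eqI:
  assumes "X v = X w" "Y v = Y w"
  shows "v = w"
proof -
  have "v = X w *\<^sub>R e1 + Y w *\<^sub>R e2" unfolding assms[symmetric] by (rule decomp)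
  also have "\<dots> = w" by (rule decomp[symmetric])
  finally show ?thesis .
qed

text \<open>Interpreting the locale in this mirrored form turns every estimate against
  \<open>up\<close> into one against \<open>um\<close>.\<close>

lemma saddle_uminus:
  "saddle A (- \<zeta>) (- up) (- um) mu l (\<lambda>v. - X v) (\<lambda>v. - Y v) (- e1) (- e2)"
proof
  show "v = - X v *\<^sub>R - e1 + - Y v *\<^sub>R - e2" for v
    unfolding scaleR_minus_left scaleR_minus_right minus_minus by (rule decomp)
qed (use um_up mu l in \<open>auto intro!: linear_compose_neg linear_X linear_Y
      simp: linear_neg[OF linear_X] linear_neg[OF linear_Y] X_simps Y_simps\<close>)

lemma solution_coords:
  assumes "is_solution A \<zeta> u v x"
  obtains S where "locally_finite_set S"
    "\<And>s. s \<notin> S \<Longrightarrow> ((\<lambda>s. X (x s)) has_real_derivative mu * (X (x s) - u s)) (at s)"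
    "\<And>s. s \<notin> S \<Longrightarrow> ((\<lambda>s. Y (x s)) has_real_derivative l * (u s - Y (x s))) (at s)"
    "continuous_on UNIV (\<lambda>s. X (x s))" "continuous_on UNIV (\<lambda>s. Y (x s))"
proof -
  from assms obtain S where S: "locally_finite_set S" "continuous_on UNIV x"
    and der: "\<And>s. s \<notin> S \<Longrightarrow> (x has_vector_derivative (A *v x s + u s *\<^sub>R \<zeta>)) (at s)"
    unfolding is_solution_def by blast
  show ?thesis
  proof (rule that[OF S(1)])
    fix s assume "s \<notin> S"
    note d = bounded_linear.has_vector_derivative[OF linear_conv_bounded_linear[THEN iffD1] der[OF this]]
    show "((\<lambda>s. X (x s)) has_real_derivative mu * (X (x s) - u s)) (at s)"
      using d[OF linear_X]
      by (simp add: has_real_derivative_iff_has_vector_derivative X_simps algebra_simps)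
    show "((\<lambda>s. Y (x s)) has_real_derivative l * (u s - Y (x s))) (at s)"
      using d[OF linear_Y]
      by (simp add: has_real_derivative_iff_has_vector_derivative Y_simps algebra_simps)
  qed (intro continuous_on_X continuous_on_Y S)+
qed

text \<open>Comparison with the constant control \<open>c\<close>: after multiplication by the
  integrating factor \<open>exp (- (mu * s))\<close>, the distance \<open>X - c\<close> has
  derivative proportional to \<open>c - u s\<close>, which is nonnegative.\<close>

lemma X_grows_above_control_bound:
  assumes "is_solution A \<zeta> u v x" "a \<le> b" "\<And>s. a < s \<Longrightarrow> s < b \<Longrightarrow> u s \<le> c"
  shows "exp (mu * (b - a)) * (X (x a) - c) \<le> X (x b) - c"
proof -
  obtain S where S: "locally_finite_set S" "continuous_on UNIV (\<lambda>s. X (x s))"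
    and der: "\<And>s. s \<notin> S \<Longrightarrow> ((\<lambda>s. X (x s)) has_real_derivative mu * (X (x s) - u s)) (at s)"
    using solution_coords[OF assms(1)] by metis
  have "exp (- (mu * a)) * (X (x a) - c) + 0 * (b - a) \<le> exp (- (mu * b)) * (X (x b) - c)"
  proof (rule nonneg_deriv_imp_le_off_locally_finite[OF S(1) _ assms(2),
        where f' = "\<lambda>s. mu * exp (- (mu * s)) * (c - u s)"])
    show "continuous_on UNIV (\<lambda>s. exp (- (mu * s)) * (X (x s) - c))"
      by (intro continuous_intros S)
  qed (use mu assms(3) in \<open>auto intro!: derivative_eq_intros der simp: algebra_simps\<close>)
  then have "exp (mu * b) * (exp (- (mu * a)) * (X (x a) - c))
      \<le> exp (mu * b) * (exp (- (mu * b)) * (X (x b) - c))"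
    by simp
  then show ?thesis
    unfolding exp_mult_exp_mult by (simp add: right_diff_distrib)
qed

lemma Y_decays_to_control_bound:
  assumes "is_solution A \<zeta> u v x" "a \<le> b" "\<And>s. a < s \<Longrightarrow> s < b \<Longrightarrow> u s \<le> c"
  shows "Y (x b) - c \<le> exp (- l * (b - a)) * (Y (x a) - c)"
proof -
  obtain S where S: "locally_finite_set S" "continuous_on UNIV (\<lambda>s. Y (x s))"
    and der: "\<And>s. s \<notin> S \<Longrightarrow> ((\<lambda>s. Y (x s)) has_real_derivative l * (u s - Y (x s))) (at s)"
    using solution_coords[OF assms(1)] by metis
  have "exp (l * a) * (c - Y (x a)) + 0 * (b - a) \<le> exp (l * b) * (c - Y (x b))"
  proof (rule nonneg_deriv_imp_le_off_locally_finite[OF S(1) _ assms(2),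
        where f' = "\<lambda>s. l * exp (l * s) * (c - u s)"])
    show "continuous_on UNIV (\<lambda>s. exp (l * s) * (c - Y (x s)))"
      by (intro continuous_intros S)
  qed (use l assms(3) in \<open>auto intro!: derivative_eq_intros der simp: algebra_simps\<close>)
  then have "exp (- (l * b)) * (exp (l * a) * (c - Y (x a)))
      \<le> exp (- (l * b)) * (exp (l * b) * (c - Y (x b)))"
    by simp
  then show ?thesis
    unfolding exp_mult_exp_mult by (simp add: right_diff_distrib)
qed

lemma solution_uminus: "is_solution A (- \<zeta>) (\<lambda>s. - u s) = is_solution A \<zeta> u"
  by (simp add: fun_eq_iff is_solution_def)

text \<open>The one-sided bounds for \<open>c\<close> and their mirror images for \<open>- c\<close>
  coincide. Prescribing the control only on the open interval lets phases be joined at a switching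
  time.\<close>

lemma constant_control_flow:
  assumes "is_solution A \<zeta> u v x" "a \<le> b" "\<And>s. a < s \<Longrightarrow> s < b \<Longrightarrow> u s = c"
  shows "X (x b) = c + exp (mu * (b - a)) * (X (x a) - c)"
    and "Y (x b) = c + exp (- l * (b - a)) * (Y (x a) - c)"
proof -
  interpret neg: saddle A "- \<zeta>" "- up" "- um" mu l "\<lambda>v. - X v" "\<lambda>v. - Y v" "- e1" "- e2"
    by (rule saddle_uminus)
  have neg: "is_solution A (- \<zeta>) (\<lambda>s. - u s) v x" using assms(1) by (simp add: solution_uminus)
  show "X (x b) = c + exp (mu * (b - a)) * (X (x a) - c)"
    using X_grows_above_control_bound[OF assms(1,2), of c] assms(3)
      neg.X_grows_above_control_bound[OF neg assms(2), of "- c"]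
    by (simp add: algebra_simps)
  show "Y (x b) = c + exp (- l * (b - a)) * (Y (x a) - c)"
    using Y_decays_to_control_bound[OF assms(1,2), of c] assms(3)
      neg.Y_decays_to_control_bound[OF neg assms(2), of "- c"]
    by (simp add: algebra_simps)
qed

lemma solution_ex:
  assumes "u \<in> control_functions {um..up}"
  shows "\<exists>x. is_solution A \<zeta> u v x"
proof -
  from assms obtain S where S: "locally_finite_set S" "\<And>s t. s \<le> t \<Longrightarrow> {s..t} \<inter> S = {} \<Longrightarrow> u s = u t"
    and bnd: "range u \<subseteq> {um..up}"
    unfolding control_functions_def piecewise_constant_def by blast
  obtain p where p: "continuous_on UNIV p" "p 0 = X v"
    "\<And>s. s \<notin> S \<Longrightarrow> (p has_real_derivative (mu * p s + (- mu) * u s)) (at s)"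
    using piecewise_constant_linear_ode_ex[OF S bnd] by metis
  obtain q where q: "continuous_on UNIV q" "q 0 = Y v"
    "\<And>s. s \<notin> S \<Longrightarrow> (q has_real_derivative ((- l) * q s + l * u s)) (at s)"
    using piecewise_constant_linear_ode_ex[OF S bnd] by metis
  define x where "x s = p s *\<^sub>R e1 + q s *\<^sub>R e2" for s
  have Xx: "X (x s) = p s" and Yx: "Y (x s) = q s" for s
    by (simp_all add: x_def X_simps Y_simps)
  have "(x has_vector_derivative (A *v x s + u s *\<^sub>R \<zeta>)) (at s)" if "s \<notin> S" for s
  proof -
    have "(x has_vector_derivative ((mu * p s + (- mu) * u s) *\<^sub>R e1 + ((- l) * q s + l * u s) *\<^sub>R e2)) (at s)"
      unfolding x_def using p(3)[OF that] q(3)[OF that]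
      by (auto intro!: derivative_eq_intros simp: has_real_derivative_iff_has_vector_derivative)
    also have "(mu * p s + (- mu) * u s) *\<^sub>R e1 + ((- l) * q s + l * u s) *\<^sub>R e2 = A *v x s + u s *\<^sub>R \<zeta>"
      by (rule eqI) (simp_all add: X_simps Y_simps Xx Yx)
    finally show ?thesis .
  qed
  moreover have "x 0 = v" by (rule eqI) (simp_all add: Xx Yx p q)
  moreover have "continuous_on UNIV x" unfolding x_def by (intro continuous_intros p q)
  ultimately show ?thesis using S(1) unfolding is_solution_def by blast
qed

text \<open>The difference of two solutions obeys the homogeneous equation, so each coordinate times
  its integrating factor is constant off the union of both exceptional sets. Negative times count as
  well, since solutions live on the whole line.\<close>

lemma solution_unique:
  assumes "is_solution A \<zeta> u v x" "is_solution A \<zeta> u v y"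
  shows "x = y"
proof
  fix t
  obtain S where S: "locally_finite_set S"
    "\<And>s. s \<notin> S \<Longrightarrow> ((\<lambda>s. X (x s)) has_real_derivative mu * (X (x s) - u s)) (at s)"
    "\<And>s. s \<notin> S \<Longrightarrow> ((\<lambda>s. Y (x s)) has_real_derivative l * (u s - Y (x s))) (at s)"
    "continuous_on UNIV (\<lambda>s. X (x s))" "continuous_on UNIV (\<lambda>s. Y (x s))"
    using solution_coords[OF assms(1)] by blast
  obtain T where T: "locally_finite_set T"
    "\<And>s. s \<notin> T \<Longrightarrow> ((\<lambda>s. X (y s)) has_real_derivative mu * (X (y s) - u s)) (at s)"
    "\<And>s. s \<notin> T \<Longrightarrow> ((\<lambda>s. Y (y s)) has_real_derivative l * (u s - Y (y s))) (at s)"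
    "continuous_on UNIV (\<lambda>s. X (y s))" "continuous_on UNIV (\<lambda>s. Y (y s))"
    using solution_coords[OF assms(2)] by blast
  have x0: "x 0 = y 0" using assms by (simp add: is_solution_def)
  note ST = locally_finite_set_Un[OF S(1) T(1)]
  have const: "f t = f 0"
    if "continuous_on UNIV f" "\<And>s. s \<notin> S \<union> T \<Longrightarrow> (f has_real_derivative 0) (at s)" for f
  proof (cases "0 \<le> t")
    case True
    then show ?thesis
      using zero_deriv_imp_eq_off_locally_finite[OF ST that(1) True that(2)] by simp
  next
    case False
    then have "t \<le> 0" by simp
    then show ?thesis
      by (rule zero_deriv_imp_eq_off_locally_finite[OF ST that(1) _ that(2)])
  qed
  have "exp (- (mu * t)) * (X (x t) - X (y t)) = exp (- (mu * 0)) * (X (x 0) - X (y 0))"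
  proof (rule const[where f = "\<lambda>t. exp (- (mu * t)) * (X (x t) - X (y t))"])
    fix s assume "s \<notin> S \<union> T"
    then show "((\<lambda>t. exp (- (mu * t)) * (X (x t) - X (y t))) has_real_derivative 0) (at s)"
      by (auto intro!: derivative_eq_intros S(2) T(2) simp: algebra_simps)
  qed (intro continuous_intros S(4) T(4))
  moreover have "exp (l * t) * (Y (x t) - Y (y t)) = exp (l * 0) * (Y (x 0) - Y (y 0))"
  proof (rule const[where f = "\<lambda>t. exp (l * t) * (Y (x t) - Y (y t))"])
    fix s assume "s \<notin> S \<union> T"
    then show "((\<lambda>t. exp (l * t) * (Y (x t) - Y (y t))) has_real_derivative 0) (at s)"
      by (auto intro!: derivative_eq_intros S(3) T(3) simp: algebra_simps)
  qed (intro continuous_intros S(5) T(5))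
  ultimately show "x t = y t" by (intro eqI) (simp_all add: x0)
qed

text \<open>Uniqueness lets the definite description in \<open>trajectory\<close> be replaced by any
  solution at hand.\<close>

lemma trajectory_eq: "is_solution A \<zeta> u v x \<Longrightarrow> trajectory A \<zeta> t v u = x t"
  unfolding trajectory_def by (metis solution_unique the_equality)

lemma is_solution_trajectory:
  assumes "u \<in> control_functions {um..up}"
  shows "is_solution A \<zeta> u v (\<lambda>t. trajectory A \<zeta> t v u)"
proof -
  obtain x where x: "is_solution A \<zeta> u v x" using solution_ex[OF assms] by blast
  show ?thesis unfolding trajectory_eq[OF x] by (simp add: x)
qed


section \<open>Growth, decay and invariant regions of trajectories\<close>

lemma step_control: "c \<in> {um..up} \<Longrightarrow> d \<in> {um..up} \<Longrightarrow> (\<lambda>s. if s < T then c else d) \<in> control_functions {um..up}"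
  unfolding control_functions_def piecewise_constant_def
  by (auto simp: locally_finite_set_def intro!: exI[of _ "{T}"])

lemma control_bounds:
  assumes "u \<in> control_functions {um..up}"
  shows "um \<le> u s" "u s \<le> up"
  using assms by (auto simp: control_functions_def image_subset_iff)

lemma trajectory_0: "u \<in> control_functions {um..up} \<Longrightarrow> trajectory A \<zeta> 0 v u = v"
  using is_solution_trajectory[of u v] by (simp add: is_solution_def)

lemma trajectory_X_growth:
  assumes "u \<in> control_functions {um..up}" "0 \<le> t"
  shows "exp (mu * t) * (X v - up) \<le> X (trajectory A \<zeta> t v u) - up"
  using X_grows_above_control_bound[OF is_solution_trajectory[OF assms(1)] assms(2), of up v]
    control_bounds[OF assms(1)] by (simp add: trajectory_0[OF assms(1)])

lemma trajectory_Y_decay: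
  assumes "u \<in> control_functions {um..up}" "0 \<le> t"
  shows "Y (trajectory A \<zeta> t v u) - up \<le> exp (- l * t) * (Y v - up)"
  using Y_decays_to_control_bound[OF is_solution_trajectory[OF assms(1)] assms(2), of up v]
    control_bounds[OF assms(1)] by (simp add: trajectory_0[OF assms(1)])

lemma X_above_increases:
  assumes "u \<in> control_functions {um..up}" "0 < t" "up < X v"
  shows "X v < X (trajectory A \<zeta> t v u)"
proof -
  have "1 * (X v - up) < exp (mu * t) * (X v - up)"
    using assms mu by (intro mult_strict_right_mono) auto
  then show ?thesis using trajectory_X_growth[OF assms(1), of t v] assms(2) by simp
qed

lemma Y_above_decreases:
  assumes "u \<in> control_functions {um..up}" "0 < t" "up < Y v"
  shows "Y (trajectory A \<zeta> t v u) < Y v"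
proof -
  have "exp (- l * t) * (Y v - up) < 1 * (Y v - up)"
    using assms l by (intro mult_strict_right_mono) auto
  then show ?thesis using trajectory_Y_decay[OF assms(1), of t v] assms(2) by simp
qed

lemma up_le_X_invariant:
  assumes "u \<in> control_functions {um..up}" "0 \<le> t" "up \<le> X v"
  shows "up \<le> X (trajectory A \<zeta> t v u)"
  using trajectory_X_growth[OF assms(1,2), of v] assms(3)
  by (smt (verit) mult_nonneg_nonneg exp_ge_zero)

lemma Y_le_up_invariant:
  assumes "u \<in> control_functions {um..up}" "0 \<le> t" "Y v \<le> up"
  shows "Y (trajectory A \<zeta> t v u) \<le> up"
  using trajectory_Y_decay[OF assms(1,2), of v] assms(3)
  by (smt (verit) mult_nonneg_nonpos exp_ge_zero)

text \<open>The control cancels in the derivative of \<open>X / mu + Y / l\<close>, which is \<open>X - Y\<close>.\<close>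

lemma corner_functional_growth:
  assumes u: "u \<in> control_functions {um..up}" and t: "0 \<le> t" and v: "up \<le> X v" "Y v \<le> up"
  shows "X v / mu + Y v / l + exp (- l * t) * (up - Y v) * t
    \<le> X (trajectory A \<zeta> t v u) / mu + Y (trajectory A \<zeta> t v u) / l"
proof -
  let ?x = "\<lambda>s. trajectory A \<zeta> s v u"
  obtain S where S: "locally_finite_set S"
    "\<And>s. s \<notin> S \<Longrightarrow> ((\<lambda>s. X (?x s)) has_real_derivative mu * (X (?x s) - u s)) (at s)"
    "\<And>s. s \<notin> S \<Longrightarrow> ((\<lambda>s. Y (?x s)) has_real_derivative l * (u s - Y (?x s))) (at s)"
    "continuous_on UNIV (\<lambda>s. X (?x s))" "continuous_on UNIV (\<lambda>s. Y (?x s))"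
    using solution_coords[OF is_solution_trajectory[OF u, of v]] by blast
  have "X (?x 0) / mu + Y (?x 0) / l + exp (- l * t) * (up - Y v) * (t - 0)
      \<le> X (?x t) / mu + Y (?x t) / l"
  proof (rule nonneg_deriv_imp_le_off_locally_finite[OF S(1) _ t,
        where f = "\<lambda>s. X (?x s) / mu + Y (?x s) / l" and f' = "\<lambda>s. X (?x s) - Y (?x s)"])
    show "continuous_on UNIV (\<lambda>s. X (?x s) / mu + Y (?x s) / l)"
      using mu l by (intro continuous_intros S) auto
    fix s assume s: "s \<notin> S" "0 < s" "s < t"
    show "((\<lambda>s. X (?x s) / mu + Y (?x s) / l) has_real_derivative X (?x s) - Y (?x s)) (at s)"
      using DERIV_add[OF DERIV_cdivide[OF S(2)[OF s(1)], of mu] DERIV_cdivide[OF S(3)[OF s(1)], of l]]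
        mu l by simp
    \<comment> \<open>The gap \<open>up - Y\<close> shrinks at most like
      \<open>exp (- l * s)\<close>, which is smallest at the final time \<open>t\<close>, while
      \<open>X\<close> stays at or above \<open>up\<close>.\<close>
    have "exp (- l * t) * (up - Y v) \<le> exp (- l * s) * (up - Y v)"
      using s l v by (intro mult_right_mono) auto
    also have "\<dots> \<le> up - Y (?x s)"
      using trajectory_Y_decay[OF u, of s v] s by (simp add: algebra_simps)
    also have "\<dots> \<le> X (?x s) - Y (?x s)"
      using up_le_X_invariant[OF u _ v(1), of s] s by simp
    finally show "exp (- l * t) * (up - Y v) \<le> X (?x s) - Y (?x s)" .
  qed
  then show ?thesis by (simp add: trajectory_0[OF u])
qed

section \<open>Confinement of viable, approximately controllable sets\<close>

text \<open>A point that every trajectory leaves by increasing a function which then never decreases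
  cannot be approached again.\<close>

lemma viable_no_strict_increase:
  fixes G :: "real^2 \<Rightarrow> real"
  assumes D: "viable_approx_controllable A \<zeta> {um..up} D" "v \<in> D"
    and G: "continuous_on UNIV G"
    and R: "v \<in> R"
      "\<And>w u t. w \<in> R \<Longrightarrow> u \<in> control_functions {um..up} \<Longrightarrow> 0 \<le> t \<Longrightarrow> trajectory A \<zeta> t w u \<in> R"
    and mono: "\<And>w u t. w \<in> R \<Longrightarrow> u \<in> control_functions {um..up} \<Longrightarrow> 0 \<le> t \<Longrightarrow> G w \<le> G (trajectory A \<zeta> t w u)"
    and strict: "\<And>u. u \<in> control_functions {um..up} \<Longrightarrow> G v < G (trajectory A \<zeta> 1 v u)"
  shows False
proof -
  obtain u where u: "u \<in> control_functions {um..up}" "\<And>t. 0 \<le> t \<Longrightarrow> trajectory A \<zeta> t v u \<in> D"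
    using D unfolding viable_approx_controllable_def by blast
  define w where "w = trajectory A \<zeta> 1 v u"
  have "w \<in> D" "w \<in> R" using u R by (simp_all add: w_def)
  then have "v \<in> closure (positive_orbit A \<zeta> {um..up} w)"
    using D unfolding viable_approx_controllable_def by blast
  \<comment> \<open>The superlevel set of the continuous \<open>G\<close> at \<open>w\<close> is
    closed and contains the orbit of \<open>w\<close>, but \<open>v\<close> lies strictly below that
    level.\<close>
  moreover have "closure (positive_orbit A \<zeta> {um..up} w) \<subseteq> {z. G w \<le> G z}"
    using mono[OF \<open>w \<in> R\<close>] G
    by (intro closure_minimal) (auto simp: positive_orbit_def intro!: closed_Collect_le)
  ultimately show False using strict[OF u(1)] by (auto simp: w_def)
qed

text \<open>Below \<open>up\<close> the coordinate \<open>X\<close> may fall; truncating it at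
  \<open>up\<close> gives a continuous function that is monotone along every trajectory.\<close>

lemma viable_X_le:
  assumes D: "viable_approx_controllable A \<zeta> {um..up} D" "v \<in> D"
  shows "X v \<le> up"
proof (rule ccontr)
  assume "\<not> X v \<le> up"
  then have "up < X v" by simp
  show False
  proof (rule viable_no_strict_increase[OF D, of "\<lambda>v. max (X v) up" UNIV])
    show "continuous_on UNIV (\<lambda>v. max (X v) up)"
      by (intro continuous_intros continuous_on_X)
    fix w u and t :: real assume "u \<in> control_functions {um..up}" "0 \<le> t"
    then show "max (X w) up \<le> max (X (trajectory A \<zeta> t w u)) up"
      using X_above_increases[of u t w] by (cases "t = 0 \<or> X w \<le> up") (auto simp: trajectory_0)
  next
    fix u assume "u \<in> control_functions {um..up}"
    then show "max (X v) up < max (X (trajectory A \<zeta> 1 v u)) up"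
      using X_above_increases[of u 1 v] \<open>up < X v\<close> by auto
  qed auto
qed

text \<open>Here the excess over \<open>up\<close> decays, so the truncated coordinate enters with a
  minus sign.\<close>

lemma viable_Y_le:
  assumes D: "viable_approx_controllable A \<zeta> {um..up} D" "v \<in> D"
  shows "Y v \<le> up"
proof (rule ccontr)
  assume "\<not> Y v \<le> up"
  then have "up < Y v" by simp
  show False
  proof (rule viable_no_strict_increase[OF D, of "\<lambda>v. - max (Y v) up" UNIV])
    show "continuous_on UNIV (\<lambda>v. - max (Y v) up)"
      by (intro continuous_intros continuous_on_Y)
    fix w u and t :: real assume u: "u \<in> control_functions {um..up}" "0 \<le> t"
    show "- max (Y w) up \<le> - max (Y (trajectory A \<zeta> t w u)) up"
    proof (cases "up < Y w \<and> t \<noteq> 0")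
      case True
      then show ?thesis using Y_above_decreases[of u t w] u by auto
    next
      case False
      then show ?thesis using Y_le_up_invariant[OF u, of w] u by (auto simp: trajectory_0)
    qed
  next
    fix u assume "u \<in> control_functions {um..up}"
    then show "- max (Y v) up < - max (Y (trajectory A \<zeta> 1 v u)) up"
      using Y_above_decreases[of u 1 v] \<open>up < Y v\<close> by auto
  qed auto
qed

text \<open>The quadrant \<open>up \<le> X\<close>, \<open>Y \<le> up\<close> is forward invariant,
  and in it \<open>X / mu + Y / l\<close> never decreases. From an edge point with
  \<open>Y v < up\<close> the increase is strict, which excludes a return.\<close>

lemma viable_X_eq_imp_Y_eq:
  assumes D: "viable_approx_controllable A \<zeta> {um..up} D" "v \<in> D" and "X v = up"
  shows "Y v = up"
proof (rule ccontr)
  assume "Y v \<noteq> up"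
  then have Yv: "Y v < up" using viable_Y_le[OF D] by simp
  show False
  proof (rule viable_no_strict_increase[OF D, of "\<lambda>v. X v / mu + Y v / l" "{v. up \<le> X v \<and> Y v \<le> up}"])
    show "continuous_on UNIV (\<lambda>v. X v / mu + Y v / l)"
      using mu l by (intro continuous_intros continuous_on_X continuous_on_Y) auto
    fix w u and t :: real
    assume w: "w \<in> {v. up \<le> X v \<and> Y v \<le> up}" and u: "u \<in> control_functions {um..up}" "0 \<le> t"
    show "trajectory A \<zeta> t w u \<in> {v. up \<le> X v \<and> Y v \<le> up}"
      using w up_le_X_invariant[OF u] Y_le_up_invariant[OF u] by simp
    have "0 \<le> exp (- l * t) * (up - Y w) * t" using w u by simp
    then show "X w / mu + Y w / l \<le> X (trajectory A \<zeta> t w u) / mu + Y (trajectory A \<zeta> t w u) / l"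
      using corner_functional_growth[OF u, of w] w by simp
  next
    fix u assume u: "u \<in> control_functions {um..up}"
    have "0 < exp (- l * 1) * (up - Y v) * 1" using Yv by simp
    then show "X v / mu + Y v / l < X (trajectory A \<zeta> 1 v u) / mu + Y (trajectory A \<zeta> 1 v u) / l"
      using corner_functional_growth[OF u zero_le_one eq_refl[OF assms(3)[symmetric]] less_imp_le[OF Yv]]
      by linarith
  qed (use Yv assms(3) in auto)
qed

text \<open>The closed half plane \<open>up \<le> X\<close> is forward invariant, so approximate
  controllability from \<open>v\<close> puts all of \<open>D\<close> on the edge
  \<open>X = up\<close>, where only the corner survives.\<close>

lemma viable_X_eq_imp_singleton:
  assumes D: "viable_approx_controllable A \<zeta> {um..up} D" "v \<in> D" and "X v = up"
  shows "is_singleton D"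
proof -
  have "closure (positive_orbit A \<zeta> {um..up} v) \<subseteq> {z. up \<le> X z}"
    using up_le_X_invariant assms(3)
    by (intro closure_minimal)
      (auto simp: positive_orbit_def intro!: closed_Collect_le continuous_intros continuous_on_X)
  moreover have "D \<subseteq> closure (positive_orbit A \<zeta> {um..up} v)"
    using D unfolding viable_approx_controllable_def by blast
  ultimately have "X w = up" if "w \<in> D" for w
    using viable_X_le[OF D(1) that] that by fastforce
  then have "w = v" if "w \<in> D" for w
    using that D viable_X_eq_imp_Y_eq[OF D(1)] by (intro eqI) simp_all
  then show ?thesis using D(2) by (intro is_singletonI') auto
qed

section \<open>Transfer by symmetry and the candidate control set\<close>

lemma control_functions_uminus:
  "u \<in> control_functions {um..up} \<Longrightarrow> (\<lambda>s. - u s) \<in> control_functions {- up..- um}"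
  unfolding control_functions_def piecewise_constant_def
  by (auto simp: image_subset_iff)

lemma trajectory_uminus: "trajectory A (- \<zeta>) t v (\<lambda>s. - u s) = trajectory A \<zeta> t v u"
  by (simp add: trajectory_def solution_uminus)

text \<open>The product of control and \<open>\<zeta>\<close> is unchanged when both are negated, so
  the trajectories are the same curves in the same state space.\<close>

lemma viable_uminus:
  assumes "viable_approx_controllable A \<zeta> {um..up} D"
  shows "viable_approx_controllable A (- \<zeta>) {- up..- um} D"
proof -
  have "positive_orbit A \<zeta> {um..up} v \<subseteq> positive_orbit A (- \<zeta>) {- up..- um} v" for v
    unfolding positive_orbit_def
    using trajectory_uminus[symmetric] control_functions_uminus by blast
  note orbit = closure_mono[OF this]
  show ?thesis
    unfolding viable_approx_controllable_def
  proof (intro conjI ballI)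
    fix v assume v: "v \<in> D"
    obtain u where u: "u \<in> control_functions {um..up}" "\<And>t. 0 \<le> t \<Longrightarrow> trajectory A \<zeta> t v u \<in> D"
      using assms v unfolding viable_approx_controllable_def by blast
    show "\<exists>u\<in>control_functions {- up..- um}. \<forall>t\<ge>0. trajectory A (- \<zeta>) t v u \<in> D"
      using u(2) by (intro bexI[OF _ control_functions_uminus[OF u(1)]]) (simp add: trajectory_uminus)
    show "D \<subseteq> closure (positive_orbit A (- \<zeta>) {- up..- um} v)"
      using assms v orbit[of v] unfolding viable_approx_controllable_def by blast
  qed
qed

text \<open>Open in the repelled coordinate, whose edges cannot be left and approached again; closed
  in the attracted one, whose edges are limits of reachable points.\<close>

definition core :: "(real^2) set" where
  "core = {v. um < X v \<and> X v < up \<and> um \<le> Y v \<and> Y v \<le> up}"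

lemma core_eq: "core = {s *\<^sub>R e1 + t *\<^sub>R e2 | s t. s \<in> {um<..<up} \<and> t \<in> {um..up}}"
proof (intro equalityI subsetI)
  fix v assume "v \<in> core"
  then show "v \<in> {s *\<^sub>R e1 + t *\<^sub>R e2 | s t. s \<in> {um<..<up} \<and> t \<in> {um..up}}"
    using decomp[of v] by (auto simp: core_def)
qed (auto simp: core_def X_simps Y_simps)

lemma viable_subset_core:
  assumes D: "viable_approx_controllable A \<zeta> {um..up} D" and "\<not> is_singleton D"
  shows "D \<subseteq> core"
proof
  interpret neg: saddle A "- \<zeta>" "- up" "- um" mu l "\<lambda>v. - X v" "\<lambda>v. - Y v" "- e1" "- e2"
    by (rule saddle_uminus)
  fix v assume v: "v \<in> D"
  note neg = viable_uminus[OF D]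
  have "X v \<noteq> up" using viable_X_eq_imp_singleton[OF D v] assms(2) by blast
  moreover have "X v \<noteq> um" using neg.viable_X_eq_imp_singleton[OF neg v] assms(2) by auto
  ultimately show "v \<in> core"
    using viable_X_le[OF D v] viable_Y_le[OF D v] neg.viable_X_le[OF neg v] neg.viable_Y_le[OF neg v]
    by (simp add: core_def)
qed

section \<open>Approximate controllability inside the rectangle\<close>

text \<open>The constant control that takes \<open>X\<close> from \<open>x\<close> to \<open>y\<close> in time \<open>T\<close>. Since \<open>X\<close> is
  repelled from the equilibrium, it is close to \<open>x\<close> when \<open>T\<close> is large.\<close>

definition transfer_control :: "real \<Rightarrow> real \<Rightarrow> real \<Rightarrow> real" where
  "transfer_control x y T = (exp (mu * T) * x - y) / (exp (mu * T) - 1)"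

lemma transfer_control_eq:
  assumes "0 < T"
  shows "transfer_control x y T + exp (mu * T) * (x - transfer_control x y T) = y"
proof -
  have "exp (mu * T) \<noteq> 1" using assms mu by simp
  then have "transfer_control x y T * (exp (mu * T) - 1) = exp (mu * T) * x - y"
    by (simp add: transfer_control_def)
  then show ?thesis by (simp add: algebra_simps)
qed

lemma transfer_control_tendsto: "(transfer_control x y \<longlongrightarrow> x) at_top"
  unfolding transfer_control_def[abs_def] using mu by real_asymp

lemma transfer_control_eventually:
  assumes "x \<in> {um<..<up}"
  shows "\<forall>\<^sub>F T in at_top. transfer_control x y T \<in> {um..up}"
  using topological_tendstoD[OF transfer_control_tendsto[of x y] open_greaterThanLessThan assms]
  by (auto elim!: eventually_mono)

text \<open>First steer \<open>X\<close> to \<open>Y w\<close>; then staying close to the equilibrium of the control \<open>Y w\<close>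
  for a long time aligns \<open>Y\<close> with \<open>Y w\<close> while \<open>X\<close> escapes to \<open>X w\<close>.\<close>

lemma interior_approx_reachable:
  assumes v: "X v \<in> {um<..<up}" and w: "X w \<in> {um<..<up}" "Y w \<in> {um<..<up}"
  shows "w \<in> closure (positive_orbit A \<zeta> {um..up} v)"
proof -
  have "\<forall>\<^sub>F T in at_top. 0 < T \<and> transfer_control (X v) (Y w) T \<in> {um..up}"
    using transfer_control_eventually[OF v, of "Y w"] eventually_gt_at_top[of 0]
    by eventually_elim simp
  then obtain T where T: "0 < T" "transfer_control (X v) (Y w) T \<in> {um..up}"
    using eventually_happens'[OF trivial_limit_at_top_linorder] by blast
  define c where "c = transfer_control (X v) (Y w) T"
  define d where "d = transfer_control (Y w) (X w)"
  \<comment> \<open>\<open>y\<close> is the value of \<open>Y\<close> after the first phase, and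
    \<open>z \<tau>\<close> the state after a second phase of length \<open>\<tau>\<close>: its
    \<open>X\<close> is already exact, and its \<open>Y\<close> tends to \<open>Y w\<close>.\<close>
  define y where "y = c + exp (- l * T) * (Y v - c)"
  define z where "z \<tau> = X w *\<^sub>R e1 + (d \<tau> + exp (- l * \<tau>) * (y - d \<tau>)) *\<^sub>R e2" for \<tau>
  have "(z \<longlongrightarrow> X w *\<^sub>R e1 + (Y w + 0 * (y - Y w)) *\<^sub>R e2) at_top"
    unfolding z_def d_def
  proof (intro tendsto_intros transfer_control_tendsto)
    show "((\<lambda>\<tau>. exp (- l * \<tau>)) \<longlongrightarrow> 0) at_top" using l by real_asymp
  qed
  then have lim: "(z \<longlongrightarrow> w) at_top" using decomp[of w] by simp
  \<comment> \<open>The second control tends to \<open>Y w\<close>, which is interior to the control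
    range, so it is admissible for all large \<open>\<tau>\<close>.\<close>
  have "\<forall>\<^sub>F \<tau> in at_top. z \<tau> \<in> positive_orbit A \<zeta> {um..up} v"
    using transfer_control_eventually[OF w(2), of "X w"] eventually_gt_at_top[of 0]
  proof eventually_elim
    case (elim \<tau>)
    define u where "u s = (if s < T then c else d \<tau>)" for s
    have u: "u \<in> control_functions {um..up}"
      unfolding u_def using elim(1) T(2) by (intro step_control) (simp_all add: c_def d_def)
    note x = is_solution_trajectory[OF u, of v]
    let ?x = "\<lambda>t. trajectory A \<zeta> t v u"
    have XT: "X (?x T) = Y w" and YT: "Y (?x T) = y"
      using constant_control_flow[OF x, of 0 T c] T(1) transfer_control_eq[OF T(1), of "X v" "Y w"]
      by (simp_all add: u_def trajectory_0[OF u] c_def y_def)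
    have "?x (T + \<tau>) = z \<tau>"
      using constant_control_flow[OF x, of T "T + \<tau>" "d \<tau>"] elim(2) transfer_control_eq[OF elim(2), of "Y w" "X w"]
      by (intro eqI) (simp_all add: XT YT z_def X_simps Y_simps, simp_all add: u_def d_def)
    then show ?case
      using u T(1) elim(2) unfolding positive_orbit_def by (auto intro!: exI[of _ "T + \<tau>"] exI[of _ u])
  qed
  then have "\<forall>\<^sub>F \<tau> in at_top. z \<tau> \<in> closure (positive_orbit A \<zeta> {um..up} v)"
    by (rule eventually_mono) (use closure_subset in blast)
  then show ?thesis
    using Lim_in_closed_set[OF closed_closure _ _ lim] by simp
qed

text \<open>Only targets with \<open>Y w\<close> on an edge are new; they are limits of interior
  targets along the line of constant \<open>X\<close>, and the closure of the orbit is
  closed.\<close>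

lemma core_approx_reachable:
  assumes "v \<in> core" "w \<in> core"
  shows "w \<in> closure (positive_orbit A \<zeta> {um..up} v)"
proof -
  let ?f = "\<lambda>y. X w *\<^sub>R e1 + y *\<^sub>R e2"
  have "?f ` closure {um<..<up} \<subseteq> closure (positive_orbit A \<zeta> {um..up} v)"
    using assms
    by (intro image_closure_subset continuous_intros closed_closure)
      (auto simp: core_def X_simps Y_simps intro!: interior_approx_reachable)
  moreover have "Y w \<in> closure {um<..<up}" using assms um_up by (simp add: core_def)
  moreover have "?f (Y w) = w" by (rule decomp[symmetric])
  ultimately show ?thesis by (metis image_subset_iff)
qed

text \<open>The constant control \<open>X v\<close> freezes \<open>X\<close> at its unstable
  equilibrium, while \<open>Y\<close> moves along the segment from \<open>Y v\<close> towards
  \<open>X v\<close>, inside the convex control range.\<close>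

lemma core_viable: "viable_approx_controllable A \<zeta> {um..up} core"
  unfolding viable_approx_controllable_def
proof (intro conjI ballI subsetI core_approx_reachable)
  fix v assume v: "v \<in> core"
  \<comment> \<open>A constant control in the shape of a degenerate step, so that
    \<open>step_control\<close> yields admissibility.\<close>
  define u where "u s = (if s < 0 then X v else X v)" for s :: real
  have u: "u \<in> control_functions {um..up}"
    unfolding u_def using v by (intro step_control) (auto simp: core_def)
  have "trajectory A \<zeta> t v u \<in> core" if "0 \<le> t" for t
  proof -
    have *: "X (trajectory A \<zeta> t v u) = X v"
      "Y (trajectory A \<zeta> t v u) = X v + exp (- l * t) * (Y v - X v)"
      using constant_control_flow[OF is_solution_trajectory[OF u] that, of "X v" v]
      by (simp_all add: u_def trajectory_0[OF u])
    have "exp (- l * t) \<le> 1" using l that by simp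
    then have "(1 - exp (- l * t)) *\<^sub>R X v + exp (- l * t) *\<^sub>R Y v \<in> {um..up}"
      using v by (intro convexD_alt[OF convex_real_interval(5)]) (auto simp: core_def)
    then show ?thesis using v * by (simp add: core_def algebra_simps)
  qed
  then show "\<exists>u\<in>control_functions {um..up}. \<forall>t\<ge>0. trajectory A \<zeta> t v u \<in> core"
    using u by blast
qed

lemma core_not_singleton: "\<not> is_singleton core"
proof
  define m where "m = (um + up) / 2"
  assume "is_singleton core"
  moreover have "m *\<^sub>R e1 + um *\<^sub>R e2 \<in> core" "m *\<^sub>R e1 + up *\<^sub>R e2 \<in> core"
    using um_up by (simp_all add: core_def X_simps Y_simps m_def)
  ultimately have "m *\<^sub>R e1 + um *\<^sub>R e2 = m *\<^sub>R e1 + up *\<^sub>R e2"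
    by (metis is_singletonE singletonD)
  then have "Y (m *\<^sub>R e1 + um *\<^sub>R e2) = Y (m *\<^sub>R e1 + up *\<^sub>R e2)" by (rule arg_cong)
  then show False using um_up by (simp add: Y_simps)
qed

text \<open>Every competitor that is not a singleton lies in \<open>core\<close>, which itself
  qualifies; this gives both the maximality of \<open>core\<close> and its uniqueness.\<close>

theorem control_set_iff_core:
  "control_set A \<zeta> {um..up} C \<and> \<not> is_singleton C \<longleftrightarrow> C = core"
proof
  assume C: "control_set A \<zeta> {um..up} C \<and> \<not> is_singleton C"
  then have "C \<subseteq> core" by (intro viable_subset_core) (simp_all add: control_set_def)
  then show "C = core" using C core_viable unfolding control_set_def by blast
next
  assume "C = core"
  have "core \<noteq> {}"
    using um_up by (auto simp: core_def X_simps Y_simps intro!: exI[of _ "((um + up) / 2) *\<^sub>R e1 + um *\<^sub>R e2"])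
  moreover have "D = core" if "viable_approx_controllable A \<zeta> {um..up} D" "core \<subseteq> D" for D
  proof -
    have "\<not> is_singleton D"
      using that(2) core_not_singleton \<open>core \<noteq> {}\<close> by (metis is_singleton_def subset_singletonD)
    then show ?thesis using viable_subset_core[OF that(1)] that(2) by blast
  qed
  ultimately show "control_set A \<zeta> {um..up} C \<and> \<not> is_singleton C"
    unfolding \<open>C = core\<close> control_set_def using core_viable core_not_singleton by blast
qed

end

section \<open>Return to the given eigenbasis\<close>

lemma scaled_basis_rectangle:
  fixes b1 b2 :: "'a::real_vector"
  shows "{s *\<^sub>R p *\<^sub>R b1 + t *\<^sub>R q *\<^sub>R b2 | s t. s \<in> S \<and> t \<in> T} =
    {x *\<^sub>R b1 + y *\<^sub>R b2 | x y. (x, y) \<in> ((*) p ` S) \<times> ((*) q ` T)}" (is "?L = ?R")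
proof (intro equalityI subsetI)
  fix v assume "v \<in> ?L"
  then obtain s t where st: "s \<in> S" "t \<in> T" and "v = s *\<^sub>R p *\<^sub>R b1 + t *\<^sub>R q *\<^sub>R b2"
    by blast
  then have "v = (p * s) *\<^sub>R b1 + (q * t) *\<^sub>R b2" by (simp add: mult.commute)
  moreover have "(p * s, q * t) \<in> ((*) p ` S) \<times> ((*) q ` T)" using st by blast
  ultimately show "v \<in> ?R" by blast
next
  fix v assume "v \<in> ?R"
  then obtain s t where st: "s \<in> S" "t \<in> T" and "v = (p * s) *\<^sub>R b1 + (q * t) *\<^sub>R b2"
    by blast
  then have "v = s *\<^sub>R p *\<^sub>R b1 + t *\<^sub>R q *\<^sub>R b2" by (simp add: mult.commute)
  then show "v \<in> ?L" using st by blast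
qed

text \<open>\<open>rot \<zeta>\<close> is orthogonal to every multiple of
  \<open>\<zeta>\<close>.\<close>

lemma eigenvector_imp_not_LARC: "A *v \<zeta> = c *\<^sub>R \<zeta> \<Longrightarrow> \<not> LARC A \<zeta>"
  by (simp add: LARC_def rot_def inner_vec_def UNIV_2 algebra_simps)

text \<open>The dual basis, obtained by linear extension of 0-1 values on the basis vectors.\<close>

lemma coordinate_functionals:
  fixes b1 b2 :: "real^2"
  assumes "independent {b1, b2}" "span {b1, b2} = UNIV" "b1 \<noteq> b2"
  obtains P Q :: "real^2 \<Rightarrow> real" where "linear P" "linear Q"
    "P b1 = 1" "P b2 = 0" "Q b1 = 0" "Q b2 = 1" "\<And>v. v = P v *\<^sub>R b1 + Q v *\<^sub>R b2"
proof -
  obtain P :: "real^2 \<Rightarrow> real" where P: "linear P" "\<forall>x\<in>{b1, b2}. P x = (if x = b1 then 1 else 0)"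
    using linear_independent_extend[OF assms(1), of "\<lambda>x. if x = b1 then 1 else 0"] by blast
  obtain Q :: "real^2 \<Rightarrow> real" where Q: "linear Q" "\<forall>x\<in>{b1, b2}. Q x = (if x = b1 then 0 else 1)"
    using linear_independent_extend[OF assms(1), of "\<lambda>x. if x = b1 then 0 else 1"] by blast
  have vals: "P b1 = 1" "P b2 = 0" "Q b1 = 0" "Q b2 = 1" using P(2) Q(2) assms(3) by auto
  have "v = P v *\<^sub>R b1 + Q v *\<^sub>R b2" for v
  proof -
    have "v \<in> span {b1, b2}" using assms(2) by simp
    then obtain a b where v: "v = a *\<^sub>R b1 + b *\<^sub>R b2"
      by (auto simp: span_insert algebra_simps)
    have "P v = a" "Q v = b"
      by (simp_all add: v linear_add[OF P(1)] linear_cmul[OF P(1)] linear_add[OF Q(1)]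
          linear_cmul[OF Q(1)] vals)
    then show ?thesis using v by simp
  qed
  then show ?thesis using that P(1) Q(1) vals by blast
qed

theorem theorem3p6:
  fixes A :: "real^2^2" and \<zeta> b1 b2 :: "real^2"
    and um up mu lam \<zeta>1 \<zeta>2 :: real and \<Omega> :: "real set"
  assumes "\<zeta> \<noteq> 0"
    and "um < up" and "\<Omega> = {um..up}"
    and "LARC A \<zeta>"
    and "det A < 0"
    and "independent {b1, b2}" and "span {b1, b2} = UNIV"
    and "A *v b1 = mu *\<^sub>R b1" and "A *v b2 = lam *\<^sub>R b2"
    and "lam < 0" and "0 < mu"
    and "\<zeta> = \<zeta>1 *\<^sub>R b1 + \<zeta>2 *\<^sub>R b2"
  shows "(\<exists>!C. control_set A \<zeta> \<Omega> C \<and> \<not> is_singleton C) \<and>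
         (\<forall>C. control_set A \<zeta> \<Omega> C \<and> \<not> is_singleton C \<longrightarrow>
            C = {x *\<^sub>R b1 + y *\<^sub>R b2 | x y.
                   (x, y) \<in> ((*) (- (\<zeta>1 / mu)) ` interior \<Omega>) \<times> ((*) (- (\<zeta>2 / lam)) ` \<Omega>)})"
proof -
  have "b1 \<noteq> 0" using assms(6) dependent_zero by blast
  \<comment> \<open>Independence of the set \<open>{b1, b2}\<close> permits coinciding vectors;
    eigenvalues of opposite sign do not.\<close>
  have "b1 \<noteq> b2"
  proof
    assume "b1 = b2"
    then have "mu *\<^sub>R b1 = lam *\<^sub>R b1" using assms(8,9) by metis
    then show False using \<open>b1 \<noteq> 0\<close> assms(10,11) by simp
  qed
  then obtain P Q :: "real^2 \<Rightarrow> real" where PQ: "linear P" "linear Q"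
    and vals: "P b1 = 1" "P b2 = 0" "Q b1 = 0" "Q b2 = 1"
    and decomp: "\<And>v. v = P v *\<^sub>R b1 + Q v *\<^sub>R b2"
    using coordinate_functionals[OF assms(6,7)] by metis
  note simps = linear_add[OF PQ(1)] linear_cmul[OF PQ(1)] linear_add[OF PQ(2)] linear_cmul[OF PQ(2)]
    linear_neg[OF PQ(1)] linear_neg[OF PQ(2)] vals
  have A: "A *v v = (mu * P v) *\<^sub>R b1 + (lam * Q v) *\<^sub>R b2" for v
  proof -
    have "A *v v = A *v (P v *\<^sub>R b1 + Q v *\<^sub>R b2)" by (rule arg_cong[OF decomp])
    then show ?thesis
      by (simp add: matrix_vector_right_distrib matrix_vector_mult_scaleR assms(8,9) mult.commute)
  qed
  \<comment> \<open>A vanishing coordinate would make \<open>\<zeta>\<close> an eigenvector. Both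
    coordinates serve as divisors in the rescaling below.\<close>
  have "\<zeta>1 \<noteq> 0"
  proof
    assume "\<zeta>1 = 0"
    then have "A *v \<zeta> = lam *\<^sub>R \<zeta>" by (simp add: A assms(12) simps)
    then show False using eigenvector_imp_not_LARC assms(4) by blast
  qed
  have "\<zeta>2 \<noteq> 0"
  proof
    assume "\<zeta>2 = 0"
    then have "A *v \<zeta> = mu *\<^sub>R \<zeta>" by (simp add: A assms(12) simps)
    then show False using eigenvector_imp_not_LARC assms(4) by blast
  qed
  \<comment> \<open>The scaling gives \<open>A *v (e1 + e2) = - \<zeta>\<close>, so the equilibrium
    of a constant control \<open>c\<close> has both new coordinates equal to
    \<open>c\<close>.\<close>
  define e1 where "e1 = (- (\<zeta>1 / mu)) *\<^sub>R b1"
  define e2 where "e2 = (- (\<zeta>2 / lam)) *\<^sub>R b2"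
  interpret saddle A \<zeta> um up mu "- lam" "\<lambda>v. - (mu / \<zeta>1) * P v" "\<lambda>v. - (lam / \<zeta>2) * Q v" e1 e2
  proof (rule saddle.intro)
    show "linear (\<lambda>v. - (mu / \<zeta>1) * P v)" "linear (\<lambda>v. - (lam / \<zeta>2) * Q v)"
      by (auto intro!: linearI simp: simps algebra_simps add_divide_distrib)
    show "v = (- (mu / \<zeta>1) * P v) *\<^sub>R e1 + (- (lam / \<zeta>2) * Q v) *\<^sub>R e2" for v
    proof -
      have "(- (mu / \<zeta>1) * P v) *\<^sub>R e1 + (- (lam / \<zeta>2) * Q v) *\<^sub>R e2 = P v *\<^sub>R b1 + Q v *\<^sub>R b2"
        using \<open>\<zeta>1 \<noteq> 0\<close> \<open>\<zeta>2 \<noteq> 0\<close> assms(10,11) by (simp add: e1_def e2_def)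
      then show ?thesis using decomp[of v] by metis
    qed
  qed (use \<open>\<zeta>1 \<noteq> 0\<close> \<open>\<zeta>2 \<noteq> 0\<close> assms(2,10,11) in \<open>simp_all add: A assms(12) e1_def e2_def simps\<close>)
  have "core = {x *\<^sub>R b1 + y *\<^sub>R b2 | x y.
      (x, y) \<in> ((*) (- (\<zeta>1 / mu)) ` interior \<Omega>) \<times> ((*) (- (\<zeta>2 / lam)) ` \<Omega>)}"
    unfolding core_eq assms(3) interior_atLeastAtMost_real e1_def e2_def
    by (rule scaled_basis_rectangle)
  moreover have "control_set A \<zeta> \<Omega> C \<and> \<not> is_singleton C \<longleftrightarrow> C = core" for C
    unfolding assms(3) by (rule control_set_iff_core)
  ultimately show ?thesis by simp
qed

end
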